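(* Let $n$ and $k$ be nonnegative integers with $n\ge 2k$. For every graph $G\in\mathcal{M}_{n,k}$ we have $b^A_g(G)=b^I_g(G)=k$.
   Context: The balance game on a finite simple graph $G$ is played by two players, Admirable (A) and Impish (I), who alternately select a not-yet-labeled vertex of $G$ until all vertices are labeled; Admirable labels each vertex she selects by $0$ and Impish labels each vertex he selects by $1$. Each edge receives the sum modulo $2$ of the labels of its endpoints. Let $e_0$ and $e_1$ be the numbers of edges labeled $0$ and $1$ at the end; the discrepancy is $d=e_1-e_0$. Admirable tries to minimize $d$ and Impish tries to maximize $d$. $b^A_g(G)$ is the value of $d$ under optimal play when Admirable moves first, and $b^I_g(G)$ is the value under optimal play when Impish moves first. The class $\mathcal{M}_{n,k}$ consists of the graphs on $n$ vertices obtained as follows. Take $\lfloor n/2\rfloor$ disjoint vertex pairs $f_1,\dots,f_{\lfloor n/2\rfloor}$, where each of $f_1,\dots,f_k$ induces a copy of $K_2$ (the two vertices are adjacent) and each of $f_{k+1},\dots,f_{\lfloor n/2\rfloor}$ induces $\overline{K_2}$ (the two vertices are nonadjacent); if $n$ is odd, add one further vertex $v$. Between any two pairs $f_i,f_j$ ($i\ne j$) insert either no edges, or a $P_3$ (i.e., one vertex of one pair is joined to both vertices of the other pair, and no other edges between them), or a $K_{2,2}$ (all four edges between the two pairs). Between $v$ and any pair $f_i$ insert either no edges or a $P_3$ (i.e., $v$ is joined to both vertices of $f_i$). No other edges are present. *)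

theory Defs
  imports Main "HOL-Library.Disjoint_Sets"
begin

definition finite_simple_graph :: "'a set \<Rightarrow> 'a set set \<Rightarrow> bool" where
  "finite_simple_graph V E \<longleftrightarrow> finite V \<and> (\<forall>e\<in>E. e \<subseteq> V \<and> card e = 2)"

datatype player = Admirable | Impish

fun opponent :: "player \<Rightarrow> player" where
  "opponent Admirable = Impish"
| "opponent Impish = Admirable"

fun player_label :: "player \<Rightarrow> nat" where
  "player_label Admirable = 0"
| "player_label Impish = 1"

definition edge_label :: "('a \<rightharpoonup> nat) \<Rightarrow> 'a set \<Rightarrow> nat" where
  "edge_label l e = (\<Sum>u\<in>e. the (l u)) mod 2"

definition discrepancy :: "'a set set \<Rightarrow> ('a \<rightharpoonup> nat) \<Rightarrow> int" where
  "discrepancy E l =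
     int (card {e \<in> E. edge_label l e = 1}) - int (card {e \<in> E. edge_label l e = 0})"

fun best :: "player \<Rightarrow> int set \<Rightarrow> int" where
  "best Admirable S = Min S"
| "best Impish S = Max S"

text \<open>
  The value of a position under optimal play, by backward induction: \<open>l\<close> is the partial labeling
  built so far and \<open>p\<close> is the player to move. The first branch also covers an infinite set of
  unlabeled vertices, which never arises on a finite graph.
\<close>

function game_value :: "'a set \<Rightarrow> 'a set set \<Rightarrow> player \<Rightarrow> ('a \<rightharpoonup> nat) \<Rightarrow> int" where
  "game_value V E p l =
     (if V - dom l = {} \<or> infinite (V - dom l) then discrepancy E l
      else best p ((\<lambda>u. game_value V E (opponent p) (l(u \<mapsto> player_label p))) ` (V - dom l)))"
  by pat_completeness auto
termination
proof (relation "measure (\<lambda>(V, E, p, l). card (V - dom l))", goal_cases)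
  case 1
  show ?case by simp
next
  case (2 V E p l u)
  then have "V - dom (l(u \<mapsto> player_label p)) \<subset> V - dom l" by auto
  with 2 have "card (V - dom (l(u \<mapsto> player_label p))) < card (V - dom l)"
    by (intro psubset_card_mono) auto
  then show ?case by simp
qed

declare game_value.simps [simp del]

definition bgA :: "'a set \<Rightarrow> 'a set set \<Rightarrow> int" where
  "bgA V E = game_value V E Admirable Map.empty"

definition bgI :: "'a set \<Rightarrow> 'a set set \<Rightarrow> int" where
  "bgI V E = game_value V E Impish Map.empty"

definition edges_between :: "'a set set \<Rightarrow> 'a set \<Rightarrow> 'a set \<Rightarrow> 'a set set" where
  "edges_between E A B = {e \<in> E. \<exists>a\<in>A. \<exists>b\<in>B. e = {a, b}}"

definition all_edges_between :: "'a set \<Rightarrow> 'a set \<Rightarrow> 'a set set" where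
  "all_edges_between A B = {{a, b} | a b. a \<in> A \<and> b \<in> B}"

text \<open>
  The three admissible connections of two pairs: no edges, a \<open>P\<^sub>3\<close> (centred in
  either pair), or a \<open>K\<^bsub>2,2\<^esub>\<close>.
\<close>

definition pairs_connection :: "'a set set \<Rightarrow> 'a set \<Rightarrow> 'a set \<Rightarrow> bool" where
  "pairs_connection E A B \<longleftrightarrow>
     edges_between E A B = {} \<or>
     (\<exists>a\<in>A. edges_between E A B = all_edges_between {a} B) \<or>
     (\<exists>b\<in>B. edges_between E A B = all_edges_between A {b}) \<or>
     edges_between E A B = all_edges_between A B"

definition vertex_connection :: "'a set set \<Rightarrow> 'a \<Rightarrow> 'a set \<Rightarrow> bool" where
  "vertex_connection E v B \<longleftrightarrow>
     edges_between E {v} B = {} \<or> edges_between E {v} B = all_edges_between {v} B"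

text \<open>
  Membership of the graph \<open>(V, E)\<close> in \<open>\<M>\<^bsub>n,k\<^esub>\<close>: there is a choice of
  the pairs \<open>f 1, \<dots>, f (n div 2)\<close> and of the extra vertex \<open>v\<close> when \<open>n\<close> is odd.
  Every two-element subset of \<open>V\<close> is either a pair or joins two distinct pairs or joins \<open>v\<close> to
  a pair, so no clause is needed to exclude other edges.
\<close>

definition class_M :: "nat \<Rightarrow> nat \<Rightarrow> 'a set \<Rightarrow> 'a set set \<Rightarrow> bool" where
  "class_M n k V E \<longleftrightarrow>
     finite_simple_graph V E \<and>
     (\<exists>f :: nat \<Rightarrow> 'a set.
        (\<forall>i\<in>{1..n div 2}. card (f i) = 2) \<and>
        disjoint_family_on f {1..n div 2} \<and>
        (\<forall>i\<in>{1..n div 2}. f i \<in> E \<longleftrightarrow> i \<le> k) \<and>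
        (\<forall>i\<in>{1..n div 2}. \<forall>j\<in>{1..n div 2}. i \<noteq> j \<longrightarrow> pairs_connection E (f i) (f j)) \<and>
        (if even n then V = (\<Union>i\<in>{1..n div 2}. f i)
         else \<exists>v. v \<notin> (\<Union>i\<in>{1..n div 2}. f i) \<and>
                  V = insert v (\<Union>i\<in>{1..n div 2}. f i) \<and>
                  (\<forall>i\<in>{1..n div 2}. vertex_connection E v (f i))))"

end

theory Submission imports Defs begin

text \<open>
  If the two vertices of every pair end up with different labels, then the edges of each
  \<open>P\<^sub>3\<close> and \<open>K\<^bsub>2,2\<^esub>\<close> cancel and the discrepancy is \<open>k\<close>, the number of
  adjacent pairs. Either player can force this, whoever starts: whenever the opponent opens a
  pair, complete it; whenever there is no pair to complete, label \<open>v\<close> if it is free, and otherwise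
  open a new pair. In this way at most one pair is left half labelled by the player, and
  only once \<open>v\<close> is labelled; the opponent alone can complete it.
\<close>

section \<open>The balancing strategy\<close>

text \<open>The pairs are encoded by the map that swaps the two vertices of each pair. The extra
  vertex of a graph of odd order becomes the one possible fixed point in \<open>V\<close>, so both
  parities are handled at once.\<close>

locale pairing =
  fixes V :: "'a set" and \<sigma> :: "'a \<Rightarrow> 'a"
  assumes finite_V: "finite V"
    and partner_closed: "u \<in> V \<Longrightarrow> \<sigma> u \<in> V"
    and partner_partner: "u \<in> V \<Longrightarrow> \<sigma> (\<sigma> u) = u"
    and unpaired_unique: "u \<in> V \<Longrightarrow> w \<in> V \<Longrightarrow> \<sigma> u = u \<Longrightarrow> \<sigma> w = w \<Longrightarrow> u = w"
begin

definition balanced :: "('a \<rightharpoonup> nat) \<Rightarrow> bool" where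
  "balanced l \<longleftrightarrow> dom l \<subseteq> V \<and> ran l \<subseteq> {0, 1} \<and>
     (\<forall>u\<in>dom l. \<sigma> u \<in> dom l \<longrightarrow> \<sigma> u \<noteq> u \<longrightarrow> l (\<sigma> u) \<noteq> l u)"

text \<open>The unpaired vertex never belongs to this set, since it is its own partner.\<close>

definition half :: "('a \<rightharpoonup> nat) \<Rightarrow> 'a set" where
  "half l = {u \<in> dom l. \<sigma> u \<notin> dom l}"

text \<open>Meant for positions in which the opponent of \<open>p\<close> is to move.\<close>

definition safe :: "player \<Rightarrow> ('a \<rightharpoonup> nat) \<Rightarrow> bool" where
  "safe p l \<longleftrightarrow> balanced l \<and>
     (half l = {} \<or>
      (\<exists>h. half l = {h} \<and> l h = Some (player_label p) \<and> (\<forall>v\<in>V. \<sigma> v = v \<longrightarrow> v \<in> dom l)))"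

lemma player_label_opponent: "player_label (opponent p) \<noteq> player_label p"
  by (cases p) auto

lemma player_label_01: "player_label p \<in> {0, 1}"
  by (cases p) auto

text \<open>Labelling \<open>u\<close> can change the status of \<open>u\<close> and of its partner
  only, because an involution sends no other vertex of \<open>V\<close> to \<open>u\<close>.\<close>

lemma half_upd:
  assumes "dom l \<subseteq> V" "u \<in> V"
  shows "half (l(u \<mapsto> x)) = (if \<sigma> u \<in> dom l \<or> \<sigma> u = u then half l - {\<sigma> u} else insert u (half l))"
proof -
  have preimage: "\<sigma> w = u \<longleftrightarrow> w = \<sigma> u" if "w \<in> dom l" for w
    using that assms partner_partner by (metis subsetD)
  have "w \<in> half (l(u \<mapsto> x)) \<longleftrightarrow>
      w = u \<and> \<sigma> u \<notin> dom l \<and> \<sigma> u \<noteq> u \<or> w \<noteq> u \<and> w \<in> half l \<and> w \<noteq> \<sigma> u" for w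
    unfolding half_def using preimage[of w] by (cases "w = u") auto
  then show ?thesis by (auto simp: half_def)
qed

text \<open>The only new constraint is the one between \<open>u\<close> and its partner. An unpaired
  \<open>u\<close> is covered as well: then \<open>l (\<sigma> u)\<close> is
  \<open>None\<close>.\<close>

lemma balanced_upd:
  assumes "balanced l" "u \<in> V - dom l" "x \<in> {0, 1}" "l (\<sigma> u) \<noteq> Some x"
  shows "balanced (l(u \<mapsto> x))"
proof -
  have dom: "dom l \<subseteq> V" and ran: "ran l \<subseteq> {0, 1}"
    and bal: "\<And>w. w \<in> dom l \<Longrightarrow> \<sigma> w \<in> dom l \<Longrightarrow> \<sigma> w \<noteq> w \<Longrightarrow> l (\<sigma> w) \<noteq> l w"
    using assms(1) unfolding balanced_def by auto
  have preimage: "w = \<sigma> u" if "w \<in> V" "\<sigma> w = u" for w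
    using that partner_partner by metis
  have "(l(u \<mapsto> x)) (\<sigma> w) \<noteq> (l(u \<mapsto> x)) w"
    if "w \<in> dom (l(u \<mapsto> x))" "\<sigma> w \<in> dom (l(u \<mapsto> x))" "\<sigma> w \<noteq> w" for w
  proof (cases "w = u")
    case True
    then show ?thesis using that assms(4) by auto
  next
    case False
    then have w: "w \<in> dom l" using that by auto
    show ?thesis
    proof (cases "\<sigma> w = u")
      case True
      then have "w = \<sigma> u" using preimage w dom by blast
      then show ?thesis using True False assms(4) by auto
    next
      case s: False
      then show ?thesis using False that w bal by auto
    qed
  qed
  moreover have "ran (l(u \<mapsto> x)) \<subseteq> {0, 1}"
    using ran assms(2,3) by (subst ran_map_upd) auto
  ultimately show ?thesis using dom assms(2) unfolding balanced_def by auto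
qed

text \<open>With the unpaired vertex gone, \<open>w\<close> has a genuine partner, and the pair left
  half labelled carries the mover's own label.\<close>

lemma safe_open:
  assumes "balanced l" "half l = {}" "\<forall>v\<in>V. \<sigma> v = v \<longrightarrow> v \<in> dom l" "w \<in> V - dom l"
  shows "safe p (l(w \<mapsto> player_label p))"
proof -
  have dom: "dom l \<subseteq> V" using assms(1) by (simp add: balanced_def)
  \<comment> \<open>A labelled partner would itself be in \<open>half l\<close>, its own partner
    \<open>w\<close> being unlabelled.\<close>
  have "\<sigma> w \<notin> dom l"
    using assms(2,4) dom partner_partner[of w] unfolding half_def by auto
  moreover have "\<sigma> w \<noteq> w" using assms(3,4) by blast
  ultimately have "half (l(w \<mapsto> player_label p)) = {w}"
    using half_upd[OF dom] assms(2,4) by auto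
  moreover have "balanced (l(w \<mapsto> player_label p))"
    using assms \<open>\<sigma> w \<notin> dom l\<close> player_label_01 by (intro balanced_upd) auto
  ultimately show ?thesis using assms(3) unfolding safe_def by auto
qed

text \<open>The unpaired vertex, if there is one, is taken first, since \<open>safe\<close>
  tolerates a half labelled pair only after that. In its absence any vertex opens a pair.\<close>

lemma safe_first_move:
  assumes "V \<noteq> {}"
  shows "\<exists>w\<in>V. safe p (Map.empty(w \<mapsto> player_label p))"
proof (cases "\<exists>v\<in>V. \<sigma> v = v")
  case True
  then obtain v where v: "v \<in> V" "\<sigma> v = v" by blast
  then have "half (Map.empty(v \<mapsto> player_label p)) = {}"
    by (auto simp: half_def)
  moreover have "balanced (Map.empty(v \<mapsto> player_label p))"
    using v player_label_01[of p] by (auto simp: balanced_def)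
  ultimately show ?thesis using v unfolding safe_def by blast
next
  case False
  obtain w where "w \<in> V" using assms by blast
  with False show ?thesis
    by (intro bexI[of _ w] safe_open) (auto simp: balanced_def half_def)
qed

text \<open>The opponent can spoil the balance only by completing a pair with the label it already
  has. A half labelled pair of a safe position bears the label of \<open>p\<close>, so his move
  gives it the other one.\<close>

lemma balanced_opponent_move:
  assumes "safe p l" "u \<in> V - dom l"
  shows "balanced (l(u \<mapsto> player_label (opponent p)))"
proof (rule balanced_upd)
  show "l (\<sigma> u) \<noteq> Some (player_label (opponent p))"
  proof
    assume s: "l (\<sigma> u) = Some (player_label (opponent p))"
    then have "\<sigma> u \<in> half l" using assms(2) partner_partner by (auto simp: half_def)
    then have "l (\<sigma> u) = Some (player_label p)" using assms(1) by (auto simp: safe_def)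
    then show False using s player_label_opponent by auto
  qed
qed (use assms player_label_01 in \<open>auto simp: safe_def\<close>)

text \<open>If the opponent completes a pair or takes the unpaired vertex, no half labelled pair is
  left and no unpaired vertex is free, so opening any pair is safe. If he opens a pair, the reply
  completes it. A reply thus never takes the unpaired vertex.\<close>

lemma safe_reply:
  assumes safe: "safe p l" and u: "u \<in> V - dom l"
    and left: "V - dom (l(u \<mapsto> player_label (opponent p))) \<noteq> {}"
  defines "l' \<equiv> l(u \<mapsto> player_label (opponent p))"
  shows "\<exists>w\<in>V - dom l'. safe p (l'(w \<mapsto> player_label p))"
proof -
  have bal': "balanced l'"
    using balanced_opponent_move[OF safe u] by (simp add: l'_def)
  have dom: "dom l \<subseteq> V" using safe by (simp add: safe_def balanced_def)
  have dom': "dom l' = insert u (dom l)" by (auto simp: l'_def)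
  have half': "half l' = (if \<sigma> u \<in> dom l \<or> \<sigma> u = u then half l - {\<sigma> u} else insert u (half l))"
    unfolding l'_def using half_upd[OF dom] u by blast
  obtain w0 where w0: "w0 \<in> V - dom l'" using left by (auto simp: l'_def)
  show ?thesis
  proof (cases "\<sigma> u \<in> dom l \<or> \<sigma> u = u")
    case True
    have "half l' = {} \<and> (\<forall>v\<in>V. \<sigma> v = v \<longrightarrow> v \<in> dom l')"
    proof (cases "\<sigma> u = u")
      case fixed: True
      \<comment> \<open>The unpaired vertex \<open>u\<close> was still free, which
        \<open>safe\<close> allows only without half labelled pairs.\<close>
      then have "half l = {}" using safe u unfolding safe_def by auto
      then show ?thesis using fixed half' u unpaired_unique dom' by auto
    next
      case False
      then have "\<sigma> u \<in> half l" using True u partner_partner by (auto simp: half_def)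
      then have "half l = {\<sigma> u}" "\<forall>v\<in>V. \<sigma> v = v \<longrightarrow> v \<in> dom l"
        using safe by (auto simp: safe_def)
      then show ?thesis using half' True dom' by auto
    qed
    then show ?thesis using safe_open[OF bal' _ _ w0] w0 by blast
  next
    case False
    let ?l = "l'(\<sigma> u \<mapsto> player_label p)"
    have s: "\<sigma> u \<in> V - dom l'" using False u dom' partner_closed by auto
    have "l' u = Some (player_label (opponent p))" by (simp add: l'_def)
    then have "balanced ?l"
      using bal' s u partner_partner[of u] player_label_01 player_label_opponent
      by (intro balanced_upd) auto
    moreover have "u \<notin> half l" using u by (auto simp: half_def)
    \<comment> \<open>\<open>u\<close> enters \<open>half\<close> with the opponent's move and
      leaves it with the reply.\<close>
    then have "half ?l = half l"
      using half_upd[of l' "\<sigma> u"] bal' s u half' False dom' partner_partner[of u]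
      by (auto simp: balanced_def)
    moreover have "?l h = l h" if "h \<in> half l" for h
      using that s u dom' by (auto simp: half_def l'_def)
    ultimately have "safe p ?l"
      using safe dom' unfolding safe_def by (auto; fastforce)
    then show ?thesis using s by blast
  qed
qed

end

section \<open>Optimal moves and the value of a position\<close>

fun sgn_player :: "player \<Rightarrow> int" where
  "sgn_player Admirable = -1"
| "sgn_player Impish = 1"

lemma best_in: "finite S \<Longrightarrow> S \<noteq> {} \<Longrightarrow> best p S \<in> S"
  by (cases p) auto

text \<open>The sign makes both players maximisers, so the arguments about guarantees can be written
  once for either player.\<close>

lemma best_ge: "finite S \<Longrightarrow> x \<in> S \<Longrightarrow> sgn_player p * x \<le> sgn_player p * best p S"
  by (cases p) auto

lemma game_value_end: "V \<subseteq> dom l \<Longrightarrow> game_value V E p l = discrepancy E l"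
  by (subst game_value.simps) auto

text \<open>Used for the opponent: his optimal play is one concrete move, to which a reply can be
  given.\<close>

lemma game_value_move:
  assumes "finite V" "V - dom l \<noteq> {}"
  shows "\<exists>u\<in>V - dom l. game_value V E p l = game_value V E (opponent p) (l(u \<mapsto> player_label p))"
proof -
  let ?S = "(\<lambda>u. game_value V E (opponent p) (l(u \<mapsto> player_label p))) ` (V - dom l)"
  have "game_value V E p l = best p ?S"
    using assms by (subst game_value.simps) auto
  moreover have "best p ?S \<in> ?S" using assms by (intro best_in) auto
  ultimately show ?thesis by auto
qed

text \<open>Used for the player who follows the strategy: the optimum is no worse for the mover than
  the move the strategy prescribes.\<close>

lemma game_value_ge_move:
  assumes "finite V" "u \<in> V - dom l"
  shows "sgn_player p * game_value V E (opponent p) (l(u \<mapsto> player_label p))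
    \<le> sgn_player p * game_value V E p l"
proof -
  let ?S = "(\<lambda>u. game_value V E (opponent p) (l(u \<mapsto> player_label p))) ` (V - dom l)"
  have "game_value V E p l = best p ?S"
    using assms by (subst game_value.simps) auto
  then show ?thesis using assms by (auto intro!: best_ge)
qed

lemma opponent_opponent [simp]: "opponent (opponent p) = p"
  by (cases p) auto

section \<open>What the balancing strategy guarantees\<close>

context pairing
begin

text \<open>Each round consists of an optimal move of the opponent and a safe reply, so the game
  ends in a balanced labelling.\<close>

lemma safe_value:
  assumes final: "\<And>l. balanced l \<Longrightarrow> dom l = V \<Longrightarrow> discrepancy E l = d"
    and "safe p l"
  shows "sgn_player p * d \<le> sgn_player p * game_value V E (opponent p) l"
  using assms(2)
\<comment> \<open>A round labels two vertices, hence the strong induction.\<close>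
proof (induction "card (V - dom l)" arbitrary: l rule: less_induct)
  case less
  have bal: "balanced l" using less.prems by (simp add: safe_def)
  then have dom: "dom l \<subseteq> V" by (simp add: balanced_def)
  show ?case
  proof (cases "V - dom l = {}")
    case True
    then have "dom l = V" using dom by auto
    then show ?thesis using final[OF bal] game_value_end[of V l E "opponent p"] by simp
  next
    case False
    then obtain u where u: "u \<in> V - dom l"
      and val: "game_value V E (opponent p) l
        = game_value V E p (l(u \<mapsto> player_label (opponent p)))"
      using game_value_move[OF finite_V False, of E "opponent p"] by auto
    let ?l = "l(u \<mapsto> player_label (opponent p))"
    have bal': "balanced ?l" using balanced_opponent_move less.prems u by blast
    show ?thesis
    proof (cases "V - dom ?l = {}")
      \<comment> \<open>The opponent made the last move. No reply exists, but his move alone keeps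
        the balance.\<close>
      case True
      then have "dom ?l = V" using bal' unfolding balanced_def by blast
      then show ?thesis using final[OF bal'] game_value_end[of V ?l E p] val by simp
    next
      case False
      then obtain w where w: "w \<in> V - dom ?l" and "safe p (?l(w \<mapsto> player_label p))"
        using safe_reply less.prems u by blast
      moreover have "card (V - dom (?l(w \<mapsto> player_label p))) < card (V - dom l)"
        using u w finite_V by (intro psubset_card_mono) auto
      ultimately have
        "sgn_player p * d \<le> sgn_player p * game_value V E (opponent p) (?l(w \<mapsto> player_label p))"
        using less.hyps by blast
      also have "\<dots> \<le> sgn_player p * game_value V E p ?l"
        by (rule game_value_ge_move[OF finite_V w])
      finally show ?thesis by (simp only: val)
    qed
  qed
qed

lemma game_value_balanced:
  assumes final: "\<And>l. balanced l \<Longrightarrow> dom l = V \<Longrightarrow> discrepancy E l = d"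
  shows "game_value V E q Map.empty = d"
proof -
  have empty: "safe p Map.empty" for p
    by (auto simp: safe_def half_def balanced_def)
  have second: "sgn_player p * d \<le> sgn_player p * game_value V E (opponent p) Map.empty" for p
    using safe_value[OF final empty] .
  have first: "sgn_player p * d \<le> sgn_player p * game_value V E p Map.empty" for p
  \<comment> \<open>On the empty graph there is no first move, but the empty labelling is already
    final.\<close>
  proof (cases "V = {}")
    case True
    then show ?thesis
      using game_value_end[of V Map.empty E p] final[of Map.empty] empty[of p]
      unfolding safe_def by auto
  next
    case False
    then obtain w where w: "w \<in> V" and "safe p (Map.empty(w \<mapsto> player_label p))"
      using safe_first_move by blast
    then have "sgn_player p * d
        \<le> sgn_player p * game_value V E (opponent p) (Map.empty(w \<mapsto> player_label p))"
      using safe_value[OF final] by blast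
    also have "\<dots> \<le> sgn_player p * game_value V E p Map.empty"
      using game_value_ge_move[OF finite_V, of w Map.empty] w by simp
    finally show ?thesis .
  qed
  show ?thesis
    \<comment> \<open>Both facts concern the game started by \<open>q\<close>: one is the guarantee
      of \<open>q\<close>, the other that of the opponent. Their signs are opposite, so the two
      bounds meet.\<close>
    using first[of q] second[of "opponent q"] by (cases q) auto
qed

end

section \<open>The discrepancy of a balanced labelling\<close>

text \<open>With signs the discrepancy becomes a sum over edges, which can be regrouped by the pairs
  that the edges join.\<close>

definition edge_sign :: "('a \<rightharpoonup> nat) \<Rightarrow> 'a set \<Rightarrow> int" where
  "edge_sign l e = (if edge_label l e = 1 then 1 else -1)"

lemma discrepancy_eq_sum:
  assumes "finite E"
  shows "discrepancy E l = (\<Sum>e\<in>E. edge_sign l e)"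
proof -
  have "{e \<in> E. edge_label l e = 0} = {e \<in> E. edge_label l e \<noteq> 1}"
    by (auto simp: edge_label_def)
  then show ?thesis
    using assms by (simp add: discrepancy_def edge_sign_def sum.If_cases Int_def)
qed

lemma edge_sign_pair:
  assumes "ran l \<subseteq> {0, 1}" "a \<in> dom l" "b \<in> dom l" "a \<noteq> b"
  shows "edge_sign l {a, b} = (if l a = l b then -1 else 1)"
proof -
  obtain x y where "l a = Some x" "l b = Some y" using assms by blast
  moreover from this have "x \<in> {0, 1}" "y \<in> {0, 1}" using assms(1) by (auto intro: ranI)
  ultimately show ?thesis using assms(4) by (auto simp: edge_sign_def edge_label_def)
qed

lemma all_edges_between_commute: "all_edges_between A B = all_edges_between B A"
  unfolding all_edges_between_def by (auto simp: doubleton_eq_iff)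

lemma edges_between_commute: "edges_between E A B = edges_between E B A"
  unfolding edges_between_def by (auto simp: doubleton_eq_iff)

text \<open>Both labels 0 and 1 occur on \<open>b\<close> and \<open>b'\<close>, so the centre
  \<open>a\<close> agrees with exactly one of them and the two signs cancel.\<close>

lemma sum_edge_sign_P3:
  assumes "ran l \<subseteq> {0, 1}" "{a, b, b'} \<subseteq> dom l" "a \<notin> {b, b'}" "l b \<noteq> l b'"
  shows "(\<Sum>e\<in>all_edges_between {a} {b, b'}. edge_sign l e) = 0"
proof -
  have 01: "\<exists>x\<in>{0, 1}. l c = Some x" if "c \<in> dom l" for c
    using that assms(1) by (auto intro: ranI)
  have "all_edges_between {a} {b, b'} = {{a, b}, {a, b'}}"
    by (auto simp: all_edges_between_def)
  moreover have "{a, b} \<noteq> {a, b'}" using assms(4) by (auto simp: doubleton_eq_iff)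
  ultimately show ?thesis
    using assms 01[of a] 01[of b] 01[of b'] by (auto simp: edge_sign_pair)
qed

text \<open>Every nonempty connection is a \<open>P_3\<close> or, for \<open>K_{2,2}\<close>, two
  edge-disjoint copies of \<open>P_3\<close> with centres \<open>a\<close> and
  \<open>a'\<close>.\<close>

lemma sum_edge_sign_pairs_connection:
  assumes "ran l \<subseteq> {0, 1}" "{a, a', b, b'} \<subseteq> dom l" "{a, a'} \<inter> {b, b'} = {}"
    "l a \<noteq> l a'" "l b \<noteq> l b'" "pairs_connection E {a, a'} {b, b'}"
  shows "(\<Sum>e\<in>edges_between E {a, a'} {b, b'}. edge_sign l e) = 0"
proof -
  have B: "(\<Sum>e\<in>all_edges_between {c} {b, b'}. edge_sign l e) = 0" if "c \<in> {a, a'}" for c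
    using assms that by (intro sum_edge_sign_P3) auto
  have A: "(\<Sum>e\<in>all_edges_between {a, a'} {c}. edge_sign l e) = 0" if "c \<in> {b, b'}" for c
    using assms that by (subst all_edges_between_commute, intro sum_edge_sign_P3) auto
  have "all_edges_between {a, a'} {b, b'}
      = all_edges_between {a} {b, b'} \<union> all_edges_between {a'} {b, b'}"
    by (auto simp: all_edges_between_def)
  moreover have "all_edges_between {a} {b, b'} \<inter> all_edges_between {a'} {b, b'} = {}"
  proof -
    have "e \<notin> all_edges_between {a'} {b, b'}" if "e \<in> all_edges_between {a} {b, b'}" for e
    proof -
      have "a \<in> e" using that by (auto simp: all_edges_between_def)
      moreover have "a \<notin> {a', b, b'}" using assms(3,4) by auto
      moreover have "e' \<subseteq> {a', b, b'}" if "e' \<in> all_edges_between {a'} {b, b'}" for e'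
        using that by (auto simp: all_edges_between_def)
      ultimately show ?thesis by blast
    qed
    then show ?thesis by blast
  qed
  moreover have "all_edges_between {c} {b, b'} = {{c, b}, {c, b'}}" for c
    by (auto simp: all_edges_between_def)
  then have "finite (all_edges_between {c} {b, b'})" for c by simp
  ultimately have "(\<Sum>e\<in>all_edges_between {a, a'} {b, b'}. edge_sign l e) = 0"
    using B[of a] B[of a'] by (simp add: sum.union_disjoint)
  then show ?thesis
    using assms(6) A B unfolding pairs_connection_def by auto
qed

text \<open>Call \<open>{u, \<sigma> u}\<close> a cell: it is a pair or the unpaired vertex alone.
  Edges inside a cell have differently labelled ends and count 1 each. The remaining edges are
  sorted by the two cells they join, and each such group cancels.\<close>

lemma (in pairing) discrepancy_balanced:
  assumes graph: "finite_simple_graph V E"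
    and pairs: "\<And>a b. a \<in> V \<Longrightarrow> b \<in> V \<Longrightarrow> \<sigma> a \<noteq> a \<Longrightarrow> \<sigma> b \<noteq> b \<Longrightarrow> b \<notin> {a, \<sigma> a} \<Longrightarrow>
      pairs_connection E {a, \<sigma> a} {b, \<sigma> b}"
    and vertex: "\<And>v b. v \<in> V \<Longrightarrow> b \<in> V \<Longrightarrow> \<sigma> v = v \<Longrightarrow> \<sigma> b \<noteq> b \<Longrightarrow>
      vertex_connection E v {b, \<sigma> b}"
    and l: "balanced l" "dom l = V"
  shows "discrepancy E l = int (card {e \<in> E. \<exists>u\<in>V. e = {u, \<sigma> u}})"
proof -
  define E1 where "E1 = {e \<in> E. \<exists>u\<in>V. e = {u, \<sigma> u}}"
  define E2 where "E2 = E - E1"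
  define cells where "cells e = (\<lambda>u. {u, \<sigma> u}) ` e" for e
  have E: "e \<subseteq> V" "card e = 2" if "e \<in> E" for e
    using graph that by (auto simp: finite_simple_graph_def)
  have "finite E"
    using E finite_V by (intro finite_subset[of E "Pow V"]) auto
  have ran: "ran l \<subseteq> {0, 1}" using l by (simp add: balanced_def)
  have diff: "l u \<noteq> l (\<sigma> u)" if "u \<in> V" "\<sigma> u \<noteq> u" for u
    using that l partner_closed unfolding balanced_def by metis
  \<comment> \<open>Cells are the classes of an equivalence relation, so sharing a vertex means
    being equal.\<close>
  have cell_eq: "c \<in> {a, \<sigma> a} \<longleftrightarrow> {c, \<sigma> c} = {a, \<sigma> a}" if "a \<in> V" for a c
    using that partner_partner by auto
  have one: "edge_sign l e = 1" if e: "e \<in> E1" for e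
  proof -
    obtain u where u: "u \<in> V" "e = {u, \<sigma> u}" "e \<in> E" using e unfolding E1_def by blast
    then have "\<sigma> u \<noteq> u" using E(2)[of e] by auto
    then show ?thesis
      using u diff[of u] edge_sign_pair[OF ran, of u "\<sigma> u"] l partner_closed by auto
  qed
  have zero_fixed: "(\<Sum>e\<in>edges_between E {a, \<sigma> a} {b, \<sigma> b}. edge_sign l e) = 0"
    if "a \<in> V" "b \<in> V" "\<sigma> a = a" "\<sigma> b \<noteq> b" for a b
  proof -
    have "a \<notin> {b, \<sigma> b}" using that partner_partner by force
    then have "(\<Sum>e\<in>all_edges_between {a} {b, \<sigma> b}. edge_sign l e) = 0"
      using that l partner_closed diff by (intro sum_edge_sign_P3[OF ran]) auto
    then show ?thesis
      using vertex[OF that] that(3) by (auto simp: vertex_connection_def)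
  qed
  have zero: "(\<Sum>e\<in>edges_between E {a, \<sigma> a} {b, \<sigma> b}. edge_sign l e) = 0"
    if ab: "a \<in> V" "b \<in> V" "b \<notin> {a, \<sigma> a}" for a b
  proof (cases "\<sigma> a = a \<or> \<sigma> b = b")
    case True
    \<comment> \<open>Two distinct unpaired vertices cannot exist, so at least one of the two cells
      is a true pair.\<close>
    then consider "\<sigma> a = a" "\<sigma> b \<noteq> b" | "\<sigma> b = b" "\<sigma> a \<noteq> a"
      using ab unpaired_unique[of a b] by auto
    then show ?thesis
    proof cases
      case 1
      then show ?thesis using ab zero_fixed by blast
    next
      case 2
      then show ?thesis
        using ab zero_fixed[of b a] by (subst edges_between_commute) blast
    qed
  next
    case False
    have "x \<notin> {b, \<sigma> b}" if "x \<in> {a, \<sigma> a}" for x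
      using ab(3) that cell_eq[OF ab(1)] cell_eq[OF ab(2)] by (metis insertI1)
    then have "{a, \<sigma> a} \<inter> {b, \<sigma> b} = {}" by blast
    then show ?thesis
      using ab False l partner_closed diff pairs[of a b]
      by (intro sum_edge_sign_pairs_connection[OF ran]) auto
  qed
  have cell_class: "(\<Sum>e\<in>{x \<in> E2. cells x = cells e0}. edge_sign l e) = 0" if "e0 \<in> E2" for e0
  proof -
    have e0E: "e0 \<in> E" and e0n: "\<nexists>u. u \<in> V \<and> e0 = {u, \<sigma> u}"
      using that by (auto simp: E2_def E1_def)
    obtain a b where ab: "e0 = {a, b}" "a \<noteq> b" using E(2)[OF e0E] by (meson card_2_iff)
    then have V: "a \<in> V" "b \<in> V" using E(1)[OF e0E] by auto
    have nb: "b \<notin> {a, \<sigma> a}" using ab V e0n by auto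
    then have ne: "{a, \<sigma> a} \<noteq> {b, \<sigma> b}" using cell_eq[OF V(1)] by blast
    \<comment> \<open>An edge with the same two cells joins them in one order or the other, and an
      edge between different cells is never inside one. A fibre of \<open>cells\<close> is therefore
      a whole connection.\<close>
    have "{x \<in> E2. cells x = cells e0} = edges_between E {a, \<sigma> a} {b, \<sigma> b}"
    proof (intro subset_antisym subsetI)
      fix x assume "x \<in> {x \<in> E2. cells x = cells e0}"
      then have x: "x \<in> E" "cells x = cells e0" by (auto simp: E2_def)
      obtain c d where cd: "x = {c, d}" using E(2)[OF x(1)] by (meson card_2_iff)
      have "{{c, \<sigma> c}, {d, \<sigma> d}} = {{a, \<sigma> a}, {b, \<sigma> b}}"
        using x(2) cd ab by (simp add: cells_def)
      then have "c \<in> {a, \<sigma> a} \<and> d \<in> {b, \<sigma> b} \<or> d \<in> {a, \<sigma> a} \<and> c \<in> {b, \<sigma> b}"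
        unfolding doubleton_eq_iff[of "{c, \<sigma> c}"] cell_eq[OF V(1)] cell_eq[OF V(2)] by blast
      then show "x \<in> edges_between E {a, \<sigma> a} {b, \<sigma> b}"
        using cd x(1) unfolding edges_between_def by (blast intro: insert_commute)
    next
      fix x assume "x \<in> edges_between E {a, \<sigma> a} {b, \<sigma> b}"
      then obtain c d where cd: "x \<in> E" "x = {c, d}" "c \<in> {a, \<sigma> a}" "d \<in> {b, \<sigma> b}"
        unfolding edges_between_def by blast
      then have cells: "{c, \<sigma> c} = {a, \<sigma> a}" "{d, \<sigma> d} = {b, \<sigma> b}"
        using cell_eq V by blast+
      have "x \<notin> E1"
      proof
        assume "x \<in> E1"
        then obtain u where "u \<in> V" "{c, d} = {u, \<sigma> u}" using cd(2) by (auto simp: E1_def)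
        then have "{c, \<sigma> c} = {d, \<sigma> d}" using cell_eq by (metis insertCI)
        then show False using cells ne by simp
      qed
      then show "x \<in> {x \<in> E2. cells x = cells e0}"
        using cd(1,2) cells ab(1) by (simp add: E2_def cells_def)
    qed
    then show ?thesis using zero[OF V nb] by simp
  qed
  have "finite E2" using \<open>finite E\<close> by (simp add: E2_def)
  then have "(\<Sum>e\<in>E2. edge_sign l e)
      = (\<Sum>y\<in>cells ` E2. \<Sum>e\<in>{x \<in> E2. cells x = y}. edge_sign l e)"
    by (rule sum.image_gen)
  also have "\<dots> = 0" using cell_class by (intro sum.neutral) auto
  finally have "(\<Sum>e\<in>E2. edge_sign l e) = 0" .
  moreover have "(\<Sum>e\<in>E. edge_sign l e) = (\<Sum>e\<in>E2. edge_sign l e) + (\<Sum>e\<in>E1. edge_sign l e)"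
    unfolding E2_def using \<open>finite E\<close> by (intro sum.subset_diff) (auto simp: E1_def)
  moreover have "(\<Sum>e\<in>E1. edge_sign l e) = int (card E1)" using one by simp
  ultimately show ?thesis
    using discrepancy_eq_sum[OF \<open>finite E\<close>] by (simp add: E1_def)
qed

section \<open>Graphs of the class\<close>

text \<open>Disjointness makes the partner independent of the index. The identity outside the pairs
  is what turns the extra vertex into a fixed point.\<close>

lemma partner_exists:
  assumes "\<And>i. i \<in> I \<Longrightarrow> card (f i) = 2" "disjoint_family_on f I"
  obtains \<sigma> where "\<And>i u. i \<in> I \<Longrightarrow> u \<in> f i \<Longrightarrow> f i = {u, \<sigma> u} \<and> \<sigma> u \<noteq> u \<and> \<sigma> (\<sigma> u) = u"
    "\<And>u. u \<notin> (\<Union>i\<in>I. f i) \<Longrightarrow> \<sigma> u = u"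
proof -
  have "\<exists>w. (\<forall>i\<in>I. u \<in> f i \<longrightarrow> f i = {u, w} \<and> w \<noteq> u) \<and> (u \<notin> (\<Union>i\<in>I. f i) \<longrightarrow> w = u)" for u
  proof (cases "u \<in> (\<Union>i\<in>I. f i)")
    case True
    then obtain i where i: "i \<in> I" "u \<in> f i" by blast
    obtain x y where "f i = {x, y}" "x \<noteq> y"
      using assms(1)[OF i(1)] by (meson card_2_iff)
    then have "f i = {u, if u = x then y else x}" "(if u = x then y else x) \<noteq> u"
      using i(2) by auto
    then obtain w where w: "f i = {u, w}" "w \<noteq> u" by metis
    have "j = i" if "j \<in> I" "u \<in> f j" for j
      using assms(2) that i unfolding disjoint_family_on_def by blast
    then show ?thesis using w True by blast
  qed auto
  then obtain \<sigma> where \<sigma>: "\<And>u i. i \<in> I \<Longrightarrow> u \<in> f i \<Longrightarrow> f i = {u, \<sigma> u} \<and> \<sigma> u \<noteq> u"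
    "\<And>u. u \<notin> (\<Union>i\<in>I. f i) \<Longrightarrow> \<sigma> u = u"
    by metis
  \<comment> \<open>\<open>\<sigma> u\<close> lies in the same pair, whose only other element is
    \<open>u\<close>.\<close>
  have "\<sigma> (\<sigma> u) = u" if "i \<in> I" "u \<in> f i" for i u
  proof -
    have u: "f i = {u, \<sigma> u}" using \<sigma>(1)[OF that] by blast
    then have "\<sigma> u \<in> f i" by blast
    then have "f i = {\<sigma> u, \<sigma> (\<sigma> u)}" "\<sigma> (\<sigma> u) \<noteq> \<sigma> u" using \<sigma>(1)[OF that(1)] by blast+
    then show ?thesis using u by (metis insertCI insertE singletonD)
  qed
  then show thesis using \<sigma> that by blast
qed

theorem theorem2p7:
  fixes n k :: nat and V :: "'a set" and E :: "'a set set"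
  assumes "n \<ge> 2 * k"
    and "class_M n k V E"
  shows "bgA V E = int k \<and> bgI V E = int k"
proof -
  define I where "I = {1..n div 2}"
  obtain f where graph: "finite_simple_graph V E"
    and card: "\<And>i. i \<in> I \<Longrightarrow> card (f i) = 2"
    and disj: "disjoint_family_on f I"
    and adj: "\<And>i. i \<in> I \<Longrightarrow> f i \<in> E \<longleftrightarrow> i \<le> k"
    and conn: "\<And>i j. i \<in> I \<Longrightarrow> j \<in> I \<Longrightarrow> i \<noteq> j \<Longrightarrow> pairs_connection E (f i) (f j)"
    and V: "if even n then V = (\<Union>i\<in>I. f i)
      else \<exists>v. v \<notin> (\<Union>i\<in>I. f i) \<and> V = insert v (\<Union>i\<in>I. f i) \<and>
        (\<forall>i\<in>I. vertex_connection E v (f i))"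
    using assms(2) unfolding class_M_def I_def by blast
  obtain \<sigma> where partner: "\<And>i u. i \<in> I \<Longrightarrow> u \<in> f i \<Longrightarrow> f i = {u, \<sigma> u} \<and> \<sigma> u \<noteq> u \<and> \<sigma> (\<sigma> u) = u"
    and unpaired: "\<And>u. u \<notin> (\<Union>i\<in>I. f i) \<Longrightarrow> \<sigma> u = u"
    using partner_exists[of I f, OF card disj] by blast
  have sub: "f i \<subseteq> V" if "i \<in> I" for i using V that by (auto split: if_splits)
  have paired: "\<exists>i\<in>I. u \<in> f i" if "\<sigma> u \<noteq> u" for u using unpaired that by blast
  have vertex: "vertex_connection E v (f i)" if "v \<in> V" "\<sigma> v = v" "i \<in> I" for v i
  proof -
    \<comment> \<open>A fixed vertex lies in no pair, so it is the extra vertex of the odd case; in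
      the even case there is none.\<close>
    have "v \<notin> (\<Union>i\<in>I. f i)" using partner that(2) by blast
    then show ?thesis using V that by (auto split: if_splits)
  qed
  interpret pairing V \<sigma>
  proof
    show "finite V" using graph by (simp add: finite_simple_graph_def)
    show "\<sigma> u \<in> V" if "u \<in> V" for u
      using that paired[of u] partner[of _ u] sub by (cases "\<sigma> u = u") auto
    show "\<sigma> (\<sigma> u) = u" if "u \<in> V" for u
      using paired[of u] partner[of _ u] by (cases "\<sigma> u = u") auto
    show "u = w" if "u \<in> V" "w \<in> V" "\<sigma> u = u" "\<sigma> w = w" for u w
    proof -
      have "u \<notin> (\<Union>i\<in>I. f i)" "w \<notin> (\<Union>i\<in>I. f i)" using partner that by blast+
      then show ?thesis using V that(1,2) by (auto split: if_splits)
    qed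
  qed
  have "discrepancy E l = int (card {e \<in> E. \<exists>u\<in>V. e = {u, \<sigma> u}})"
    if "balanced l" "dom l = V" for l
  proof (rule discrepancy_balanced[OF graph _ _ that])
    fix a b assume ab: "\<sigma> a \<noteq> a" "\<sigma> b \<noteq> b" "b \<notin> {a, \<sigma> a}"
    obtain i j where ij: "i \<in> I" "a \<in> f i" "j \<in> I" "b \<in> f j" using paired ab by blast
    then have "f i = {a, \<sigma> a}" "f j = {b, \<sigma> b}" using partner by blast+
    moreover have "i \<noteq> j" using ab(3) ij(4) calculation(1) by blast
    ultimately show "pairs_connection E {a, \<sigma> a} {b, \<sigma> b}" using conn ij by metis
  next
    fix v b assume vb: "v \<in> V" "\<sigma> v = v" "\<sigma> b \<noteq> b"
    obtain j where "j \<in> I" "b \<in> f j" using paired vb by blast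
    then show "vertex_connection E v {b, \<sigma> b}" using vertex[OF vb(1,2)] partner by metis
  qed
  moreover have "card {e \<in> E. \<exists>u\<in>V. e = {u, \<sigma> u}} = k"
  proof -
    \<comment> \<open>\<open>n \<ge> 2 * k\<close> gives \<open>k \<le> n div 2\<close>, so all
      indices from 1 to \<open>k\<close> name pairs.\<close>
    have kI: "{1..k} = {i \<in> I. i \<le> k}" using \<open>n \<ge> 2 * k\<close> unfolding I_def by fastforce
    have "{e \<in> E. \<exists>u\<in>V. e = {u, \<sigma> u}} = f ` {1..k}"
    proof (intro subset_antisym subsetI)
      fix e assume "e \<in> {e \<in> E. \<exists>u\<in>V. e = {u, \<sigma> u}}"
      then obtain u where u: "e \<in> E" "e = {u, \<sigma> u}" by blast
      \<comment> \<open>An edge has two ends, so it is not the cell of the unpaired vertex.\<close>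
      then have "\<sigma> u \<noteq> u" using graph by (force simp: finite_simple_graph_def)
      then obtain i where i: "i \<in> I" "u \<in> f i" using paired by blast
      then have "e = f i" using partner u(2) by blast
      then show "e \<in> f ` {1..k}" using adj i(1) u(1) unfolding kI by blast
    next
      fix e assume "e \<in> f ` {1..k}"
      then obtain i where i: "i \<in> I" "i \<le> k" "e = f i" unfolding kI by blast
      then obtain u where "u \<in> f i" using card[of i] by fastforce
      then show "e \<in> {e \<in> E. \<exists>u\<in>V. e = {u, \<sigma> u}}"
        using partner[OF i(1)] sub[OF i(1)] adj[OF i(1)] i by blast
    qed
    \<comment> \<open>Pairs are nonempty, so equal ones meet, which disjointness permits only for
      equal indices.\<close>
    moreover have "inj_on f I"
    proof (rule inj_onI)
      fix i j assume ij: "i \<in> I" "j \<in> I" "f i = f j"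
      moreover have "f i \<noteq> {}" using card[OF ij(1)] by auto
      ultimately show "i = j" using disj unfolding disjoint_family_on_def by blast
    qed
    then have "inj_on f {1..k}" by (rule inj_on_subset) (use kI in blast)
    ultimately show ?thesis by (simp add: card_image)
  qed
  ultimately have "game_value V E q Map.empty = int k" for q
    by (intro game_value_balanced) simp
  then show ?thesis by (simp add: bgA_def bgI_def)
qed

end
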